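(* Let $k\ge 4$ be an integer and let $m=3k+1$. Let $G$ be a connected $\{\theta(1,2,2),\theta(1,2,3)\}$-free graph of size $m$ with no pendant vertices. Then $q(G)\le q'(m)$, where $q'(m)$ is the largest root of $$x^4-\tfrac13(2m+19)x^3+(4m+10)x^2-\tfrac43(5m-2)x+\tfrac83(m-4)=0.$$ Moreover, equality $q(G)=q'(m)$ holds if and only if $G\cong H^{(4)}_{\frac{2m-5}{3}}$.
   Context: All graphs are finite, simple, undirected and connected. The size of a graph is its number of edges. A pendant vertex is a vertex of degree $1$. A graph is $\mathcal F$-free if it contains no member of the family $\mathcal F$ as a (not necessarily induced) subgraph. $q(G)$ denotes the signless Laplacian spectral radius of $G$, i.e. the largest eigenvalue of $Q(G)=D(G)+A(G)$, where $A(G)$ is the adjacency matrix and $D(G)$ the diagonal matrix of vertex degrees. The theta graph $\theta(l_1,\dots,l_k)$ consists of $k\ge 3$ internally disjoint paths of lengths (numbers of edges) $l_1,\dots,l_k$, all joining the same two distinct end vertices. For odd $p\ge5$, the friendship graph $F_p$ of order $p$ consists of $\frac{p-1}{2}$ triangles having precisely one vertex (the central vertex) common to all of them. For odd $p\ge 5$ and $r\ge 4$, the graph $H_p^{(r)}$, of order $p+r-1$, is obtained from $F_p$ by identifying the central vertex of $F_p$ with a vertex of the cycle $C_r$ on $r$ vertices. *)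

theory Defs
  imports
    "Graph_Theory.Graph_Theory"
    "Jordan_Normal_Form.Spectral_Radius"
begin

text \<open>
  Finite simple undirected graphs are modelled by \<^locale>\<open>pair_graph\<close>: finite, symmetric,
  loop-free digraphs without parallel arcs. An edge \<open>uv\<close> is the pair of arcs \<open>(u,v)\<close>, \<open>(v,u)\<close>;
  hence the degree of a vertex is its out-degree, and graph isomorphism is
  \<^const>\<open>digraph_iso\<close>.
\<close>

definition graph_from_edges :: "'a set \<Rightarrow> ('a \<times> 'a) set \<Rightarrow> 'a pair_pre_digraph" where
  "graph_from_edges V E = \<lparr> pverts = V, parcs = E \<union> E\<inverse> \<rparr>"

definition edges :: "'a pair_pre_digraph \<Rightarrow> 'a set set" where
  "edges G = (\<lambda>(u, v). {u, v}) ` parcs G"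

definition graph_size :: "'a pair_pre_digraph \<Rightarrow> nat" where
  "graph_size G = card (edges G)"

definition degree_of :: "'a pair_pre_digraph \<Rightarrow> 'a \<Rightarrow> nat" where
  "degree_of G v = out_degree (with_proj G) v"

definition pendant_vertex :: "'a pair_pre_digraph \<Rightarrow> 'a \<Rightarrow> bool" where
  "pendant_vertex G v \<longleftrightarrow> v \<in> pverts G \<and> degree_of G v = 1"

definition graph_iso :: "'a pair_pre_digraph \<Rightarrow> 'b pair_pre_digraph \<Rightarrow> bool" where
  "graph_iso G H \<longleftrightarrow> digraph_iso (with_proj G) (with_proj H)"

definition contains_graph :: "'a pair_pre_digraph \<Rightarrow> 'b pair_pre_digraph \<Rightarrow> bool" where
  "contains_graph G F \<longleftrightarrow>
     (\<exists>K :: 'a pair_pre_digraph. subgraph (with_proj K) (with_proj G) \<and> graph_iso F K)"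

definition free_of :: "'b pair_pre_digraph set \<Rightarrow> 'a pair_pre_digraph \<Rightarrow> bool" where
  "free_of \<F> G \<longleftrightarrow> (\<forall>F\<in>\<F>. \<not> contains_graph G F)"

text \<open>
  The theta graph with path lengths \<open>ls\<close>: the \<open>i\<close>-th path runs from \<open>Source\<close> through
  \<open>Inner i 1, \<dots>, Inner i (ls ! i - 1)\<close> to \<open>Sink\<close>. It is meant for at least three positive
  lengths, at most one of which is \<open>1\<close>.
\<close>

datatype theta_vertex = Source | Sink | Inner nat nat

definition theta_path :: "nat list \<Rightarrow> nat \<Rightarrow> nat \<Rightarrow> theta_vertex" where
  "theta_path ls i j = (if j = 0 then Source else if j = ls ! i then Sink else Inner i j)"

definition theta_graph :: "nat list \<Rightarrow> theta_vertex pair_pre_digraph" where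
  "theta_graph ls = graph_from_edges
     {theta_path ls i j | i j. i < length ls \<and> j \<le> ls ! i}
     {(theta_path ls i j, theta_path ls i (Suc j)) | i j. i < length ls \<and> j < ls ! i}"

text \<open>
  The friendship graph of odd order \<open>p\<close>, with central vertex \<open>0\<close> and triangles
  \<open>0, 2 * i + 1, 2 * i + 2\<close>.
\<close>

definition friendship_graph :: "nat \<Rightarrow> nat pair_pre_digraph" where
  "friendship_graph p = graph_from_edges {..<p}
     (\<Union>i<(p - 1) div 2. {(0, 2 * i + 1), (0, 2 * i + 2), (2 * i + 1, 2 * i + 2)})"

definition cycle_graph :: "nat \<Rightarrow> nat pair_pre_digraph" where
  "cycle_graph r = graph_from_edges {..<r} ((\<lambda>i. (i, Suc i mod r)) ` {..<r})"

text \<open>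
  To identify vertex \<open>0\<close> of the cycle with the centre \<open>0\<close> of the friendship graph, the other
  cycle vertices \<open>1, \<dots>, r - 1\<close> are renamed to \<open>p, \<dots>, p + r - 2\<close>.
\<close>

definition H_graph :: "nat \<Rightarrow> nat \<Rightarrow> nat pair_pre_digraph" where
  "H_graph p r =
     (let f = (\<lambda>i. if i = 0 then 0 else p + i - 1)
      in \<lparr> pverts = pverts (friendship_graph p) \<union> f ` pverts (cycle_graph r),
           parcs = parcs (friendship_graph p) \<union> map_prod f f ` parcs (cycle_graph r) \<rparr>)"

text \<open>
  The rows and columns of the matrices follow an arbitrary enumeration of the vertices;
  the spectrum does not depend on its choice.
\<close>

definition vertex_list :: "'a pair_pre_digraph \<Rightarrow> 'a list" where
  "vertex_list G = (SOME vs. distinct vs \<and> set vs = pverts G)"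

definition adjacency_matrix :: "'a pair_pre_digraph \<Rightarrow> real mat" where
  "adjacency_matrix G =
     (let vs = vertex_list G; n = length vs
      in mat n n (\<lambda>(i, j). if (vs ! i, vs ! j) \<in> parcs G then 1 else 0))"

definition degree_matrix :: "'a pair_pre_digraph \<Rightarrow> real mat" where
  "degree_matrix G =
     (let vs = vertex_list G
      in mat_diag (length vs) (\<lambda>i. real (degree_of G (vs ! i))))"

definition signless_laplacian :: "'a pair_pre_digraph \<Rightarrow> real mat" where
  "signless_laplacian G = degree_matrix G + adjacency_matrix G"

definition signless_radius :: "'a pair_pre_digraph \<Rightarrow> real" where
  "signless_radius G = Max (spectrum (signless_laplacian G))"

definition q_poly :: "nat \<Rightarrow> real poly" where
  "q_poly m =
     [: 8/3 * (real m - 4), - (4/3 * (5 * real m - 2)), 4 * real m + 10,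
        - (1/3 * (2 * real m + 19)), 1 :]"

definition q_bound :: "nat \<Rightarrow> real" where
  "q_bound m = Max {x. poly (q_poly m) x = 0}"

end

theory Submission
  imports Defs
begin

text \<open>
  If \<open>y\<close> is a positive vertex weight, every eigenvalue of \<open>Q = D + A\<close> is at most the maximum of
  \<open>(Q y)\<^sub>v / y\<^sub>v\<close>. With \<open>y\<close> the degree function this gives \<open>q(G) \<le> d + s / d\<close> for some vertex \<open>u\<close>
  of degree \<open>d\<close> whose neighbours have degree sum \<open>s\<close>. By \<open>\<theta>(1,2,2)\<close>-freeness the neighbourhood of \<open>u\<close>
  induces a matching, so \<open>2 s \<le> 2 m + d\<close>, and since no vertex is pendant \<open>3 d \<le> 2 m\<close>, that is
  \<open>d \<le> 2 k\<close>. By convexity in \<open>d\<close>, the bound is below \<open>2 k + 1\<close> for \<open>d \<le> 2 k - 2\<close>; for \<open>d = 2 k - 1\<close>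
  it can be improved to \<open>2 k + 1 + 1 / (2 k - 1)\<close>. Both are smaller than \<open>q'(m)\<close>.
  If some vertex has degree \<open>2 k\<close>, the edge count leaves only the friendship graph with a
  4-cycle attached, for which the largest root \<open>q'(m)\<close> has an explicit positive eigenvector;
  the weight bound applied to that eigenvector shows that it is the largest eigenvalue.
\<close>

section \<open>Eigenvalues of the signless Laplacian\<close>

definition nbrs :: "'a pair_pre_digraph \<Rightarrow> 'a \<Rightarrow> 'a set" where
  "nbrs G v = {w. (v, w) \<in> parcs G}"

lemma nbrs_iff [simp]: "w \<in> nbrs G v \<longleftrightarrow> (v, w) \<in> parcs G"
  by (simp add: nbrs_def)

lemma degree_of_eq_card_nbrs: "degree_of G v = card (nbrs G v)"
proof -
  have "out_arcs (with_proj G) v = Pair v ` nbrs G v"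
    by (auto simp: out_arcs_def)
  then show ?thesis
    by (simp add: degree_of_def out_degree_def card_image inj_on_def)
qed

lemma (in pair_fin_digraph) finite_nbrs: "finite (nbrs G v)"
  by (rule finite_subset[OF _ pair_finite_verts]) (auto dest: in_arcsD2)

lemma vertex_list:
  assumes "finite (pverts G)"
  shows "distinct (vertex_list G)" "set (vertex_list G) = pverts G"
proof -
  have "\<exists>vs. distinct vs \<and> set vs = pverts G"
    using finite_distinct_list[OF assms] by blast
  from someI_ex[OF this] show "distinct (vertex_list G)" "set (vertex_list G) = pverts G"
    unfolding vertex_list_def by blast+
qed

text \<open>Vertex functions make eigenvectors independent of the enumeration
  \<open>vertex_list\<close>.\<close>

definition is_eigenfun :: "'a pair_pre_digraph \<Rightarrow> ('a \<Rightarrow> real) \<Rightarrow> real \<Rightarrow> bool" where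
  "is_eigenfun G f l \<longleftrightarrow> (\<exists>v\<in>pverts G. f v \<noteq> 0) \<and>
     (\<forall>v\<in>pverts G. real (degree_of G v) * f v + (\<Sum>w\<in>nbrs G v. f w) = l * f v)"

lemma signless_laplacian_carrier:
  "signless_laplacian G \<in> carrier_mat (length (vertex_list G)) (length (vertex_list G))"
  by (simp add: signless_laplacian_def degree_matrix_def adjacency_matrix_def Let_def mat_diag_def)

lemma (in pair_fin_digraph) signless_laplacian_mult_vec:
  assumes "i < length (vertex_list G)"
  shows "(signless_laplacian G *\<^sub>v vec (length (vertex_list G)) (\<lambda>j. f (vertex_list G ! j))) $ i =
    real (degree_of G (vertex_list G ! i)) * f (vertex_list G ! i) + (\<Sum>w\<in>nbrs G (vertex_list G ! i). f w)"
proof -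
  define vs n where "vs = vertex_list G" and "n = length vs"
  have i: "i < n" using assms by (simp add: vs_def n_def)
  have bij: "bij_betw ((!) vs) {0..<n} (pverts G)"
    using vertex_list[OF pair_finite_verts]
    by (intro bij_betw_nth) (auto simp: vs_def n_def)
  have entry: "signless_laplacian G $$ (i, j) * f (vs ! j) =
      (if i = j then real (degree_of G (vs ! i)) * f (vs ! j) else 0)
        + (if (vs ! i, vs ! j) \<in> parcs G then f (vs ! j) else 0)" if "j < n" for j
    using i that unfolding signless_laplacian_def degree_matrix_def adjacency_matrix_def Let_def
      vs_def[symmetric] n_def[symmetric]
    by (simp add: mat_diag_def distrib_right)
  have "(signless_laplacian G *\<^sub>v vec n (\<lambda>j. f (vs ! j))) $ i =
      (\<Sum>j\<in>{0..<n}. signless_laplacian G $$ (i, j) * f (vs ! j))"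
    using signless_laplacian_carrier[of G, folded vs_def, folded n_def] i
    by (auto simp: scalar_prod_def)
  also have "\<dots> = (\<Sum>j\<in>{0..<n}. (if i = j then real (degree_of G (vs ! i)) * f (vs ! j) else 0)
        + (if (vs ! i, vs ! j) \<in> parcs G then f (vs ! j) else 0))"
    by (intro sum.cong refl entry) simp
  also have "\<dots> = real (degree_of G (vs ! i)) * f (vs ! i)
      + (\<Sum>j\<in>{0..<n}. if (vs ! i, vs ! j) \<in> parcs G then f (vs ! j) else 0)"
    using i by (simp add: sum.distrib)
  also have "(\<Sum>j\<in>{0..<n}. if (vs ! i, vs ! j) \<in> parcs G then f (vs ! j) else 0)
      = (\<Sum>w\<in>pverts G. if (vs ! i, w) \<in> parcs G then f w else 0)"
    by (rule sum.reindex_bij_betw[OF bij])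
  also have "\<dots> = (\<Sum>w\<in>nbrs G (vs ! i). f w)"
    by (rule sum.mono_neutral_cong_right) (auto simp: pair_finite_verts dest: in_arcsD2)
  finally show ?thesis by (simp add: vs_def n_def)
qed

lemma (in pair_fin_digraph) eigenvalue_signless_laplacian_iff:
  "eigenvalue (signless_laplacian G) l \<longleftrightarrow> (\<exists>f. is_eigenfun G f l)"
proof -
  define vs n where "vs = vertex_list G" and "n = length vs"
  note vl = vertex_list[OF pair_finite_verts, folded vs_def]
  note car = signless_laplacian_carrier[of G, folded vs_def, folded n_def]
  note mv = signless_laplacian_mult_vec[folded vs_def, folded n_def]
  have dr: "dim_row (signless_laplacian G) = n" using car by auto
  have nz: "vec n (\<lambda>j. f (vs ! j)) \<noteq> 0\<^sub>v n \<longleftrightarrow> (\<exists>v\<in>pverts G. f v \<noteq> 0)" for f :: "'a \<Rightarrow> real"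
    unfolding vl(2)[symmetric] by (simp add: vec_eq_iff n_def) (metis in_set_conv_nth)
  have eq: "signless_laplacian G *\<^sub>v vec n (\<lambda>j. f (vs ! j)) = l \<cdot>\<^sub>v vec n (\<lambda>j. f (vs ! j)) \<longleftrightarrow>
     (\<forall>v\<in>pverts G. real (degree_of G v) * f v + (\<Sum>w\<in>nbrs G v. f w) = l * f v)" (is "?a = ?b") for f
  proof -
    have "?a \<longleftrightarrow> (\<forall>i<n. (signless_laplacian G *\<^sub>v vec n (\<lambda>j. f (vs ! j))) $ i = l * f (vs ! i))"
      using dr by (auto simp: vec_eq_iff)
    also have "\<dots> \<longleftrightarrow> (\<forall>i<n. real (degree_of G (vs ! i)) * f (vs ! i)
        + (\<Sum>w\<in>nbrs G (vs ! i). f w) = l * f (vs ! i))"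
      by (simp add: mv)
    also have "\<dots> \<longleftrightarrow> ?b"
      unfolding vl(2)[symmetric] by (simp add: all_set_conv_all_nth n_def)
    finally show ?thesis .
  qed
  \<comment> \<open>Any vector is a vertex function read along the enumeration: invert
    \<open>(!) vs\<close>, which is injective as \<open>vs\<close> is distinct.\<close>
  have fun_of: "\<exists>f. v = vec n (\<lambda>j. f (vs ! j))" if "v \<in> carrier_vec n" for v :: "real vec"
  proof (intro exI)
    show "v = vec n (\<lambda>j. (\<lambda>x. v $ the_inv_into {..<n} ((!) vs) x) (vs ! j))"
      using that vl(1) by (intro eq_vecI)
        (auto simp: the_inv_into_f_f inj_on_nth n_def)
  qed
  show ?thesis
  proof
    assume "eigenvalue (signless_laplacian G) l"
    then obtain v where v: "v \<in> carrier_vec n" "v \<noteq> 0\<^sub>v n" "signless_laplacian G *\<^sub>v v = l \<cdot>\<^sub>v v"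
      unfolding eigenvalue_def eigenvector_def dr by blast
    obtain f where "v = vec n (\<lambda>j. f (vs ! j))" using fun_of[OF v(1)] by blast
    with v(2,3) show "\<exists>f. is_eigenfun G f l"
      using nz[of f] eq[of f] unfolding is_eigenfun_def by blast
  next
    assume "\<exists>f. is_eigenfun G f l"
    then obtain f where "is_eigenfun G f l" ..
    then show "eigenvalue (signless_laplacian G) l"
      using nz[of f] eq[of f] unfolding eigenvalue_def eigenvector_def dr is_eigenfun_def
      by (meson vec_carrier)
  qed
qed

text \<open>Take a vertex \<open>v\<close> where the ratio of |f| to \<open>y\<close> is largest. In
  the eigenequation at \<open>v\<close>, each |f w| is at most \<open>g v * y w\<close>, and the
  common factor \<open>g v\<close> cancels.\<close>

lemma (in pair_fin_digraph) eigenfun_bound: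
  assumes f: "is_eigenfun G f l"
    and pos: "\<And>v. v \<in> pverts G \<Longrightarrow> y v > 0"
  obtains v where "v \<in> pverts G"
    "l * y v \<le> real (degree_of G v) * y v + (\<Sum>w\<in>nbrs G v. y w)"
proof -
  define g where "g v = \<bar>f v\<bar> / y v" for v
  obtain v where v: "v \<in> pverts G" "\<And>w. w \<in> pverts G \<Longrightarrow> g w \<le> g v"
  proof -
    have fin: "finite (g ` pverts G)" and ne: "g ` pverts G \<noteq> {}"
      using pair_finite_verts f[unfolded is_eigenfun_def] by blast+
    obtain v where "v \<in> pverts G" "g v = Max (g ` pverts G)"
      using Max_in[OF fin ne] by (metis imageE)
    with Max_ge[OF fin] that show thesis by (metis imageI)
  qed
  obtain v0 where v0: "v0 \<in> pverts G" "f v0 \<noteq> 0"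
    using f[unfolded is_eigenfun_def] by blast
  have "0 < g v0" using v0 pos by (simp add: g_def)
  then have gv: "0 < g v" using v(2)[OF v0(1)] by linarith
  have fg: "\<bar>f w\<bar> = g w * y w" if "w \<in> pverts G" for w
    using pos[OF that] by (simp add: g_def)
  have "(l - degree_of G v) * f v = (\<Sum>w\<in>nbrs G v. f w)"
    using bspec[OF conjunct2[OF f[unfolded is_eigenfun_def]] v(1)] by (simp add: left_diff_distrib)
  then have "\<bar>l - degree_of G v\<bar> * \<bar>f v\<bar> \<le> (\<Sum>w\<in>nbrs G v. \<bar>f w\<bar>)"
    by (metis abs_mult sum_abs)
  also have "\<dots> \<le> (\<Sum>w\<in>nbrs G v. g v * y w)"
  proof (rule sum_mono)
    fix w assume "w \<in> nbrs G v"
    then have w: "w \<in> pverts G" by (auto dest: in_arcsD2)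
    show "\<bar>f w\<bar> \<le> g v * y w"
      unfolding fg[OF w] using v(2)[OF w] pos[OF w] by (intro mult_right_mono) auto
  qed
  also have "\<dots> = g v * (\<Sum>w\<in>nbrs G v. y w)" by (simp add: sum_distrib_left)
  finally have "g v * (\<bar>l - degree_of G v\<bar> * y v) \<le> g v * (\<Sum>w\<in>nbrs G v. y w)"
    using fg[OF v(1)] by (simp add: mult_ac)
  then have "\<bar>l - degree_of G v\<bar> * y v \<le> (\<Sum>w\<in>nbrs G v. y w)"
    using gv by simp
  moreover have "(l - degree_of G v) * y v \<le> \<bar>l - degree_of G v\<bar> * y v"
    using pos[OF v(1)] by (intro mult_right_mono) auto
  ultimately have "l * y v \<le> real (degree_of G v) * y v + (\<Sum>w\<in>nbrs G v. y w)"
    by (simp add: algebra_simps)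
  with v(1) that show ?thesis by blast
qed

text \<open>A complex eigenvalue \<open>z\<close> with eigenvector \<open>v\<close> satisfies
  \<open>z * (v \<bullet> conj v) = (A v) \<bullet> conj v\<close>, and both inner products are real.\<close>

lemma symmetric_real_eigenvalue_exists:
  fixes A :: "real mat"
  assumes A: "A \<in> carrier_mat n n" and n: "n > 0"
    and sym: "\<And>i j. i < n \<Longrightarrow> j < n \<Longrightarrow> A $$ (i, j) = A $$ (j, i)"
  shows "spectrum A \<noteq> {}"
proof -
  define B where "B = map_mat complex_of_real A"
  have B: "B \<in> carrier_mat n n" using A by (simp add: B_def)
  obtain z where z: "eigenvalue B z"
    using spectrum_non_empty[OF B n] by (auto simp: spectrum_def)
  then obtain v where v: "v \<in> carrier_vec n" "v \<noteq> 0\<^sub>v n" "B *\<^sub>v v = z \<cdot>\<^sub>v v"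
    using B by (auto simp: eigenvalue_def eigenvector_def)
  have row: "(\<Sum>j\<in>{0..<n}. A $$ (i, j) * v $ j) = z * v $ i" if "i < n" for i
  proof -
    have "(B *\<^sub>v v) $ i = (\<Sum>j\<in>{0..<n}. A $$ (i, j) * v $ j)"
      using that v(1) A by (auto simp: B_def scalar_prod_def intro!: sum.cong)
    then show ?thesis using v(1,3) that by simp
  qed
  define s where "s = (\<Sum>i\<in>{0..<n}. v $ i * cnj (v $ i))"
  have s_real: "s = of_real (\<Sum>i\<in>{0..<n}. (cmod (v $ i))\<^sup>2)"
    by (simp add: s_def complex_norm_square[symmetric])
  obtain i where i: "i < n" "v $ i \<noteq> 0"
    using v(1,2) by (auto simp: vec_eq_iff)
  have "(\<Sum>i\<in>{0..<n}. (cmod (v $ i))\<^sup>2) \<ge> (cmod (v $ i))\<^sup>2"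
    by (rule member_le_sum) (use i in auto)
  moreover have "(cmod (v $ i))\<^sup>2 > 0" using i by simp
  ultimately have s0: "s \<noteq> 0" unfolding s_real of_real_eq_0_iff by linarith
  have zs: "z * s = (\<Sum>i\<in>{0..<n}. \<Sum>j\<in>{0..<n}. A $$ (i, j) * v $ j * cnj (v $ i))"
    unfolding s_def sum_distrib_left using row
    by (intro sum.cong) (auto simp: sum_distrib_right[symmetric] mult.assoc[symmetric])
  have "cnj (z * s) = (\<Sum>i\<in>{0..<n}. \<Sum>j\<in>{0..<n}. A $$ (i, j) * cnj (v $ j) * v $ i)"
    unfolding zs by simp
  also have "\<dots> = (\<Sum>j\<in>{0..<n}. \<Sum>i\<in>{0..<n}. A $$ (i, j) * cnj (v $ j) * v $ i)"
    by (rule sum.swap)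
  also have "\<dots> = z * s"
    unfolding zs by (intro sum.cong refl) (auto simp: sym mult_ac)
  finally have "cnj z * s = z * s" by (simp add: s_real)
  then have "cnj z = z" using s0 by simp
  then obtain x where x: "z = of_real x" by (metis Reals_cases Reals_cnj_iff)
  \<comment> \<open>Realness passes to \<open>A\<close> through the characteristic polynomial:
    \<open>x\<close> is a root of the real polynomial itself, so no real eigenvector has to be
    extracted from \<open>v\<close>.\<close>
  have cp: "char_poly B = map_poly complex_of_real (char_poly A)"
    unfolding B_def by (rule of_real_hom.char_poly_hom[OF A])
  have "poly (map_poly complex_of_real (char_poly A)) (of_real x) = 0"
    using z unfolding eigenvalue_root_char_poly[OF B] cp x .
  then have "poly (char_poly A) x = 0" by simp
  then show ?thesis using eigenvalue_root_char_poly[OF A] by (auto simp: spectrum_def)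
qed

text \<open>\<open>signless_radius\<close> is a \<open>Max\<close>, meaningful only for a finite
  non-empty spectrum; symmetry of the matrix supplies a real eigenvalue.\<close>

lemma (in pair_graph) signless_radius_mem:
  assumes "pverts G \<noteq> {}"
  shows "finite (spectrum (signless_laplacian G))"
    "signless_radius G \<in> spectrum (signless_laplacian G)"
proof -
  let ?n = "length (vertex_list G)"
  show fin: "finite (spectrum (signless_laplacian G))"
    by (rule card_finite_spectrum[OF signless_laplacian_carrier])
  have "(u, v) \<in> parcs G \<longleftrightarrow> (v, u) \<in> parcs G" for u v
    using pair_sym_arcs unfolding symmetric_def by (auto dest: symD)
  then have sym: "signless_laplacian G $$ (i, j) = signless_laplacian G $$ (j, i)"
    if "i < ?n" "j < ?n" for i j
    using that
    by (auto simp: signless_laplacian_def degree_matrix_def adjacency_matrix_def Let_def mat_diag_def)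
  have "?n > 0" using vertex_list[OF pair_finite_verts] assms by auto
  from symmetric_real_eigenvalue_exists[OF signless_laplacian_carrier this sym] fin
  show "signless_radius G \<in> spectrum (signless_laplacian G)"
    unfolding signless_radius_def by (metis Max_in)
qed

section \<open>The polynomial\<close>

text \<open>The factored form is the eigenequation at the centre of the extremal graph, with the
  values at all other vertices eliminated and denominators \<open>x - 3\<close> and
  \<open>(x - 2)^2 - 2\<close> cleared.\<close>

lemma poly_q_poly:
  assumes "m = 3 * k + 1"
  shows "poly (q_poly m) x =
    ((x - 2 * real k) * (x - 3) - 2 * (real k - 1)) * ((x - 2)\<^sup>2 - 2) - 2 * (x - 2) * (x - 3)"
  unfolding q_poly_def assms by (simp add: field_simps power2_eq_square)

text \<open>The polynomial is monic and negative at the stated threshold, so it has a root beyond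
  it. The threshold is what degree weights give at a vertex of degree
  \<open>2 * k - 1\<close>.\<close>

lemma q_bound_root:
  assumes "k \<ge> 4" "m = 3 * k + 1"
  shows "poly (q_poly m) (q_bound m) = 0"
    and "q_bound m > 2 * real k + 1 + 1 / (2 * real k - 1)"
proof -
  \<comment> \<open>The threshold becomes \<open>j + 2 + d\<close>, and \<open>j * d = 1\<close>
    collapses the mixed products.\<close>
  define j d where "j = 2 * real k - 1" and "d = 1 / j"
  have j: "j \<ge> 7" and jd: "j * d = 1" and d: "d > 0" "d \<le> 1"
    using assms(1) by (auto simp: j_def d_def field_simps)
  let ?p = "q_poly m"
  have "poly ?p (j + 2 + d) = ((1 + d) * (j - 1 + d) - (j - 1)) * ((j + d)\<^sup>2 - 2)
      - 2 * (j + d) * (j - 1 + d)"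
    unfolding poly_q_poly[OF assms(2)] by (simp add: j_def algebra_simps)
  also have "(1 + d) * (j - 1 + d) - (j - 1) = 1 + d\<^sup>2"
    using jd by (simp add: algebra_simps power2_eq_square)
  also have "(j + d)\<^sup>2 - 2 = j\<^sup>2 + d\<^sup>2"
    using jd by (simp add: algebra_simps power2_eq_square)
  also have "(1 + d\<^sup>2) * (j\<^sup>2 + d\<^sup>2) = j\<^sup>2 + d\<^sup>2 + (j * d)\<^sup>2 + d\<^sup>2 * d\<^sup>2"
    by (simp add: algebra_simps)
  also have "2 * (j + d) * (j - 1 + d) = 2 * j\<^sup>2 + 4 * (j * d) + 2 * d\<^sup>2 - 2 * j - 2 * d"
    by (simp add: algebra_simps power2_eq_square)
  finally have val: "poly ?p (j + 2 + d) = d\<^sup>2 * d\<^sup>2 - d\<^sup>2 + 2 * d + 2 * j - j\<^sup>2 - 3"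
    by (simp add: jd)
  \<comment> \<open>In \<open>val\<close>, the terms in \<open>d\<close> contribute at most 2, while
    j^2 \<ge> 7j outweighs 2j.\<close>
  have "d\<^sup>2 \<le> 1" using d by (simp add: power_le_one)
  then have "d\<^sup>2 * d\<^sup>2 \<le> d\<^sup>2" using mult_left_le[of "d\<^sup>2" "d\<^sup>2"] by simp
  moreover have "j\<^sup>2 \<ge> 7 * j" using j by (simp add: power2_eq_square mult_right_mono)
  ultimately have neg: "poly ?p (j + 2 + d) < 0" using j d unfolding val by linarith
  have lc: "lead_coeff ?p = 1" and nz: "?p \<noteq> 0" by (auto simp: q_poly_def)
  obtain b where b: "\<And>x. x \<ge> b \<Longrightarrow> poly ?p x \<ge> 1"
    using poly_pinfty_gt_lc[of ?p] lc by auto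
  have "poly ?p (max b (j + 3 + d)) \<ge> 1" by (rule b) simp
  then obtain x where x: "x > j + 2 + d" "poly ?p x = 0"
    using poly_IVT_pos[OF _ neg, of "max b (j + 3 + d)"] by force
  have fin: "finite {x. poly ?p x = 0}" by (rule poly_roots_finite[OF nz])
  show "poly ?p (q_bound m) = 0"
    using Max_in[OF fin] x(2) unfolding q_bound_def by blast
  have "x \<le> q_bound m"
    unfolding q_bound_def by (rule Max_ge[OF fin]) (simp add: x(2))
  with x(1) show "q_bound m > 2 * real k + 1 + 1 / (2 * real k - 1)"
    by (simp add: j_def d_def)
qed

section \<open>Isomorphisms and theta subgraphs\<close>

lemma graph_isoI:
  assumes "pair_wf_digraph G" "inj_on h (pverts G)"
    "pverts H = h ` pverts G" "parcs H = map_prod h h ` parcs G"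
  shows "graph_iso G H"
proof -
  interpret pair_wf_digraph G by fact
  let ?hom = "\<lparr>iso_verts = h, iso_arcs = map_prod h h, iso_head = snd, iso_tail = fst\<rparr>"
  have "inj_on (map_prod h h) (parcs G)"
    by (rule inj_on_subset[OF map_prod_inj_on[OF assms(2) assms(2)]]) (auto dest: in_arcsD1 in_arcsD2)
  then have "digraph_isomorphism ?hom"
    using assms(2) wf_digraph by (simp add: digraph_isomorphism_def)
  moreover have "with_proj H = app_iso ?hom (with_proj G)"
    by (simp add: app_iso_def with_proj_def assms(3,4))
  ultimately show ?thesis
    unfolding graph_iso_def digraph_iso_def by blast
qed

lemma graph_iso_sym:
  assumes "pair_wf_digraph G" "graph_iso G H"
  shows "graph_iso H G"
  using digraph_iso_swap[of "with_proj G" "with_proj H"] assms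
  by (simp add: graph_iso_def wf_digraph_wp_iff)

text \<open>Serves to deny an isomorphism with the extremal graph when no vertex has degree
  \<open>2 * k\<close>.\<close>

lemma graph_iso_degree_of:
  assumes "graph_iso G H" "v \<in> pverts H"
  shows "\<exists>u\<in>pverts G. degree_of G u = degree_of H v"
proof -
  interpret pair_pre_digraph G .
  obtain hom where hom: "digraph_isomorphism hom" "with_proj H = app_iso hom (with_proj G)"
    using assms(1) unfolding graph_iso_def digraph_iso_def by blast
  have "pverts H = iso_verts hom ` pverts G"
    using arg_cong[OF hom(2), of verts] by simp
  then obtain u where u: "u \<in> pverts G" "v = iso_verts hom u" using assms(2) by blast
  have "degree_of G u = degree_of H v"
    unfolding degree_of_def hom(2) u(2) 
    using wf_digraph.out_degree_app_iso_eq[of "with_proj G" hom u] hom(1) u(1)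
    by (simp add: digraph_isomorphism_def)
  with u(1) show ?thesis by blast
qed

lemma contains_graphI:
  assumes "pair_wf_digraph G" "pair_wf_digraph F" "inj_on h (pverts F)"
    "h ` pverts F \<subseteq> pverts G" "map_prod h h ` parcs F \<subseteq> parcs G"
  shows "contains_graph G F"
proof -
  interpret F: pair_wf_digraph F by fact
  let ?K = "\<lparr>pverts = h ` pverts F, parcs = map_prod h h ` parcs F\<rparr>"
  have "pair_wf_digraph ?K"
    by unfold_locales (auto dest: F.in_arcsD1 F.in_arcsD2)
  then have "subgraph (with_proj ?K) (with_proj G)"
    using assms by (simp add: subgraph_def wf_digraph_wp_iff compatible_def)
  moreover have "graph_iso F ?K"
    by (rule graph_isoI[OF assms(2,3)]) simp_all
  ultimately show ?thesis unfolding contains_graph_def by blast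
qed

text \<open>Indexed unions over numeral ranges let simplification list the vertices and edges of
  concrete theta graphs.\<close>

lemma theta_graph_UN:
  "theta_graph ls = graph_from_edges (\<Union>i<length ls. theta_path ls i ` {..ls ! i})
     (\<Union>i<length ls. (\<lambda>j. (theta_path ls i j, theta_path ls i (Suc j))) ` {..<ls ! i})"
  unfolding theta_graph_def by (rule arg_cong2[of _ _ _ _ graph_from_edges]) blast+

lemma theta_graph_122:
  "theta_graph [1, 2, 2] = graph_from_edges {Source, Sink, Inner 1 1, Inner 2 1}
     {(Source, Sink), (Source, Inner 1 1), (Inner 1 1, Sink), (Source, Inner 2 1), (Inner 2 1, Sink)}"
  unfolding theta_graph_UN
  by (rule arg_cong2[of _ _ _ _ graph_from_edges])
     (auto simp: theta_path_def lessThan_Suc atMost_Suc numeral_eq_Suc)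

lemma theta_graph_123:
  "theta_graph [1, 2, 3] = graph_from_edges {Source, Sink, Inner 1 1, Inner 2 1, Inner 2 2}
     {(Source, Sink), (Source, Inner 1 1), (Inner 1 1, Sink), (Source, Inner 2 1),
      (Inner 2 1, Inner 2 2), (Inner 2 2, Sink)}"
  unfolding theta_graph_UN
  by (rule arg_cong2[of _ _ _ _ graph_from_edges])
     (auto simp: theta_path_def lessThan_Suc atMost_Suc numeral_eq_Suc)

lemma contains_theta_122:
  assumes "pair_graph G"
    "(s, t) \<in> parcs G" "(s, a) \<in> parcs G" "(a, t) \<in> parcs G" "(s, b) \<in> parcs G" "(b, t) \<in> parcs G"
    "a \<noteq> b"
  shows "contains_graph G (theta_graph [1, 2, 2])"
proof -
  interpret pair_graph G by fact
  have sym: "(y, x) \<in> parcs G" if "(x, y) \<in> parcs G" for x y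
    using that pair_sym_arcs unfolding symmetric_def by (auto dest: symD)
  have ne: "s \<noteq> t" "s \<noteq> a" "a \<noteq> t" "s \<noteq> b" "b \<noteq> t" using assms(2-6) no_loops' by blast+
  have v: "s \<in> pverts G" "t \<in> pverts G" "a \<in> pverts G" "b \<in> pverts G"
    using assms(2-6) in_arcsD1 in_arcsD2 by blast+
  \<comment> \<open>Path 0 is the single edge from \<open>s\<close> to \<open>t\<close> and has no
    inner vertex, so inner vertices start with path 1.\<close>
  let ?h = "\<lambda>x. case x of Source \<Rightarrow> s | Sink \<Rightarrow> t | Inner i j \<Rightarrow> if i = 1 then a else b"
  show ?thesis
    unfolding theta_graph_122
  proof (rule contains_graphI[of _ _ ?h])
    show "pair_wf_digraph (graph_from_edges {Source, Sink, Inner 1 1, Inner 2 1}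
     {(Source, Sink), (Source, Inner 1 1), (Inner 1 1, Sink), (Source, Inner 2 1), (Inner 2 1, Sink)})"
      by unfold_locales (auto simp: graph_from_edges_def)
  qed (use assms(2-) ne v pair_wf_digraph sym in \<open>auto simp: graph_from_edges_def\<close>)
qed

text \<open>The pattern is a triangle \<open>s, a, t\<close> and a 4-cycle \<open>s, b, c, t\<close>
  sharing the edge \<open>s, t\<close>. Adjacent vertices differ by looplessness; the assumed
  inequalities cover the four other pairs.\<close>

lemma contains_theta_123:
  assumes "pair_graph G"
    "(s, t) \<in> parcs G" "(s, a) \<in> parcs G" "(a, t) \<in> parcs G"
    "(s, b) \<in> parcs G" "(b, c) \<in> parcs G" "(c, t) \<in> parcs G"
    "a \<noteq> b" "a \<noteq> c" "s \<noteq> c" "b \<noteq> t"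
  shows "contains_graph G (theta_graph [1, 2, 3])"
proof -
  interpret pair_graph G by fact
  have sym: "(y, x) \<in> parcs G" if "(x, y) \<in> parcs G" for x y
    using that pair_sym_arcs unfolding symmetric_def by (auto dest: symD)
  have ne: "s \<noteq> t" "s \<noteq> a" "a \<noteq> t" "s \<noteq> b" "b \<noteq> c" "c \<noteq> t" using assms(2-7) no_loops' by blast+
  have v: "s \<in> pverts G" "t \<in> pverts G" "a \<in> pverts G" "b \<in> pverts G" "c \<in> pverts G"
    using assms(2-7) in_arcsD1 in_arcsD2 by blast+
  let ?h = "\<lambda>x. case x of Source \<Rightarrow> s | Sink \<Rightarrow> t
    | Inner i j \<Rightarrow> if i = 1 then a else if j = 1 then b else c"
  show ?thesis
    unfolding theta_graph_123
  proof (rule contains_graphI[of _ _ ?h])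
    show "pair_wf_digraph (graph_from_edges {Source, Sink, Inner 1 1, Inner 2 1, Inner 2 2}
     {(Source, Sink), (Source, Inner 1 1), (Inner 1 1, Sink), (Source, Inner 2 1),
      (Inner 2 1, Inner 2 2), (Inner 2 2, Sink)})"
      by unfold_locales (auto simp: graph_from_edges_def)
  qed (use assms(2-) ne v pair_wf_digraph sym in \<open>auto simp: graph_from_edges_def\<close>)
qed

section \<open>Edge counts around a vertex\<close>

lemma card_symmetric_irreflexive:
  assumes "finite R" "sym R" "irrefl R"
  shows "card R = 2 * card ((\<lambda>(u, v). {u, v}) ` R)"
proof -
  let ?f = "\<lambda>(u, v). {u, v}"
  have fibre: "card {p \<in> R. ?f p = e} = 2" if e: "e \<in> ?f ` R" for e
  proof -
    obtain u v where uv: "(u, v) \<in> R" "e = {u, v}" using e by auto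
    have "{p \<in> R. ?f p = e} = {(u, v), (v, u)}"
      using uv assms(2) by (auto simp: doubleton_eq_iff dest: symD)
    moreover have "u \<noteq> v" using uv assms(3) by (auto simp: irrefl_def)
    ultimately show ?thesis by simp
  qed
  have "card R = (\<Sum>e\<in>?f ` R. card {p \<in> R. ?f p = e})"
    using sum.image_gen[OF assms(1), of "\<lambda>_. 1 :: nat" ?f] by simp
  also have "\<dots> = 2 * card (?f ` R)" using fibre by simp
  finally show ?thesis .
qed

section \<open>Arc counts, parity and connectedness in an arbitrary graph\<close>

context pair_graph
begin

lemma parcs_sym: "(x, y) \<in> parcs G \<Longrightarrow> (y, x) \<in> parcs G"
  using pair_sym_arcs unfolding symmetric_def by (auto dest: symD)

text \<open>Each edge inside \<open>A\<close> contributes both orientations. The parity sharpens the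
  later counts.\<close>

lemma even_card_induced: "even (card (parcs G \<inter> A \<times> A))"
proof -
  have "sym (parcs G \<inter> A \<times> A)" "irrefl (parcs G \<inter> A \<times> A)"
    using no_loops' by (auto simp: sym_def irrefl_def parcs_sym)
  with pair_finite_arcs show ?thesis by (simp add: card_symmetric_irreflexive)
qed

lemma card_parcs: "card (parcs G) = 2 * graph_size G"
proof -
  have "sym (parcs G)" "irrefl (parcs G)"
    using no_loops' by (auto simp: sym_def irrefl_def parcs_sym)
  with pair_finite_arcs show ?thesis
    by (simp add: card_symmetric_irreflexive graph_size_def edges_def)
qed

lemma card_arcs_swap: "card (parcs G \<inter> A \<times> B) = card (parcs G \<inter> B \<times> A)"
proof -
  have "parcs G \<inter> B \<times> A = prod.swap ` (parcs G \<inter> A \<times> B)"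
    by (force simp: parcs_sym)
  then show ?thesis by (simp add: card_image)
qed

lemma sum_degree_of:
  assumes "A \<subseteq> pverts G"
  shows "(\<Sum>v\<in>A. degree_of G v) = card (parcs G \<inter> A \<times> UNIV)"
proof -
  have "parcs G \<inter> A \<times> UNIV = Sigma A (nbrs G)" by auto
  then show ?thesis
    using finite_subset[OF assms pair_finite_verts]
    by (simp add: card_SigmaI finite_nbrs degree_of_eq_card_nbrs)
qed

text \<open>Connectedness speaks of the symmetric closure, which adds nothing to symmetric arcs; a
  walk starting in \<open>C\<close> never leaves it.\<close>

lemma connected_closed_eq:
  assumes "Digraph_Component.connected (with_proj G)"
    and "C \<subseteq> pverts G" "C \<noteq> {}" and closed: "\<And>x y. (x, y) \<in> parcs G \<Longrightarrow> x \<in> C \<Longrightarrow> y \<in> C"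
  shows "C = pverts G"
proof -
  obtain c where c: "c \<in> C" using assms(3) by blast
  have sc: "(x, y) \<in> symcl (parcs G) \<Longrightarrow> (x, y) \<in> parcs G" for x y
    by (auto simp: symcl_def parcs_sym)
  have "v \<in> C" if v: "v \<in> pverts G" for v
  proof -
    have "(c, v) \<in> rtrancl_on (pverts G) (symcl (parcs G))"
      using assms(1,2) c v unfolding connected_conv by auto
    then show ?thesis
      by (induct rule: rtrancl_on_induct) (use c closed sc in auto)
  qed
  with assms(2) show ?thesis by blast
qed

end

section \<open>Graphs satisfying the hypotheses of the theorem\<close>

locale extremal_graph = pair_graph G for G :: "'a pair_pre_digraph" +
  fixes k :: nat
  assumes k: "k \<ge> 4"
    and conn: "Digraph_Component.connected (with_proj G)"
    and free: "free_of {theta_graph [1, 2, 2], theta_graph [1, 2, 3]} G"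
    and size: "graph_size G = 3 * k + 1"
    and no_pendant: "\<not> (\<exists>v. pendant_vertex G v)"
begin

text \<open>Two triangles on a common edge form theta(1,2,2), so every edge lies in at most one
  triangle.\<close>

lemma no_theta_122:
  assumes "(s, t) \<in> parcs G" "(s, a) \<in> parcs G" "(a, t) \<in> parcs G" "(s, b) \<in> parcs G" "(b, t) \<in> parcs G"
  shows "a = b"
  using contains_theta_122[OF pair_graph_axioms assms] free by (auto simp: free_of_def)

lemma no_theta_123:
  assumes "(s, t) \<in> parcs G" "(s, a) \<in> parcs G" "(a, t) \<in> parcs G"
    "(s, b) \<in> parcs G" "(b, c) \<in> parcs G" "(c, t) \<in> parcs G"
    "a \<noteq> b" "a \<noteq> c" "s \<noteq> c" "b \<noteq> t"
  shows False
  using contains_theta_123[OF pair_graph_axioms assms] free by (auto simp: free_of_def)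

text \<open>Degree 1 is excluded by assumption; an isolated vertex would be the whole connected
  graph, which has edges.\<close>

lemma degree_of_ge_2:
  assumes v: "v \<in> pverts G"
  shows "degree_of G v \<ge> 2"
proof -
  have "degree_of G v \<noteq> 1" using no_pendant v by (auto simp: pendant_vertex_def)
  moreover have "degree_of G v \<noteq> 0"
  proof
    assume "degree_of G v = 0"
    then have "nbrs G v = {}" by (simp add: degree_of_eq_card_nbrs finite_nbrs)
    then have isolated: "(v, y) \<notin> parcs G" for y by (simp add: set_eq_iff)
    have "{v} = pverts G"
      by (rule connected_closed_eq[OF conn]) (use v isolated in simp_all)
    have "(x, y) \<notin> parcs G" for x y
    proof
      assume xy: "(x, y) \<in> parcs G"
      from in_arcsD1[OF xy] have "x = v" unfolding \<open>{v} = pverts G\<close>[symmetric] by simp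
      with xy isolated show False by simp
    qed
    then have "parcs G = {}" by auto
    then have "card (parcs G) = 0" by (simp only: card.empty)
    with card_parcs size show False by linarith
  qed
  ultimately show ?thesis by linarith
qed

lemma other_neighbour:
  assumes "v \<in> pverts G"
  obtains z where "(v, z) \<in> parcs G" "z \<noteq> x"
proof -
  have "\<not> nbrs G v \<subseteq> {x}"
    using degree_of_ge_2[OF assms] card_mono[of "{x}" "nbrs G v"]
    by (auto simp: degree_of_eq_card_nbrs)
  then obtain z where "z \<in> nbrs G v" "z \<noteq> x" by blast
  with that show thesis by simp
qed

section \<open>Counting edges by their position relative to a fixed vertex\<close>

definition far :: "'a \<Rightarrow> 'a set" where
  "far u = pverts G - insert u (nbrs G u)"

text \<open>The neighbours of \<open>u\<close> on a triangle through \<open>u\<close>, written as a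
  projection of arcs so that counting them reduces to injectivity of \<open>fst\<close>.\<close>

definition matched :: "'a \<Rightarrow> 'a set" where
  "matched u = fst ` (parcs G \<inter> nbrs G u \<times> nbrs G u)"

lemma nbrs_subset: "nbrs G u \<subseteq> pverts G"
  by (auto dest: in_arcsD2)

lemma edge_cases:
  assumes "u \<in> pverts G" "(x, y) \<in> parcs G" "x \<in> nbrs G u"
  shows "y = u \<or> y \<in> nbrs G u \<or> y \<in> far u"
  using assms by (auto simp: far_def dest: in_arcsD2)

text \<open>An arc leaving \<open>nbrs G u\<close> ends at \<open>u\<close>, in
  \<open>nbrs G u\<close> or in \<open>far u\<close>.\<close>

lemma sum_degree_nbrs:
  assumes u: "u \<in> pverts G"
  shows "(\<Sum>v\<in>nbrs G u. degree_of G v) = degree_of G u + card (parcs G \<inter> nbrs G u \<times> nbrs G u)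
    + card (parcs G \<inter> nbrs G u \<times> far u)"
proof -
  let ?N = "nbrs G u"
  have eq: "parcs G \<inter> ?N \<times> UNIV = ?N \<times> {u} \<union> parcs G \<inter> ?N \<times> ?N \<union> parcs G \<inter> ?N \<times> far u"
  proof (intro equalityI subrelI)
    fix x y assume "(x, y) \<in> parcs G \<inter> ?N \<times> UNIV"
    then have "(x, y) \<in> parcs G" "x \<in> ?N" by simp_all
    with edge_cases[OF u this]
    show "(x, y) \<in> ?N \<times> {u} \<union> parcs G \<inter> ?N \<times> ?N \<union> parcs G \<inter> ?N \<times> far u" by blast
  qed (auto simp: parcs_sym)
  have 1: "(?N \<times> {u} \<union> parcs G \<inter> ?N \<times> ?N) \<inter> (parcs G \<inter> ?N \<times> far u) = {}"
    by (auto simp: far_def)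
  have 2: "?N \<times> {u} \<inter> (parcs G \<inter> ?N \<times> ?N) = {}"
    by (auto dest: no_loops')
  have fin: "finite (parcs G \<inter> X)" for X using pair_finite_arcs by blast
  have "card (?N \<times> {u}) = degree_of G u"
    by (simp add: degree_of_eq_card_nbrs card_cartesian_product)
  then show ?thesis
    unfolding sum_degree_of[OF nbrs_subset] eq
    using 1 2 fin by (simp add: card_Un_disjoint finite_nbrs)
qed

text \<open>The degree sum 2m is split over \<open>u\<close>, \<open>nbrs G u\<close> and
  \<open>far u\<close>. Arcs between classes are met in both directions, hence the factors 2; inside
  a class the arc count already includes both.\<close>

lemma edge_count:
  assumes u: "u \<in> pverts G"
  shows "6 * k + 2 = 2 * degree_of G u + card (parcs G \<inter> nbrs G u \<times> nbrs G u)
    + 2 * card (parcs G \<inter> nbrs G u \<times> far u) + card (parcs G \<inter> far u \<times> far u)"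
proof -
  let ?N = "nbrs G u" and ?W = "far u"
  have fin: "finite (parcs G \<inter> X)" for X using pair_finite_arcs by blast
  have "pverts G = insert u (?N \<union> ?W)" using u nbrs_subset by (auto simp: far_def)
  moreover have "u \<notin> ?N \<union> ?W" "?N \<inter> ?W = {}" by (auto simp: far_def dest: no_loops')
  moreover have "finite ?N" "finite ?W" using finite_nbrs pair_finite_verts by (auto simp: far_def)
  ultimately have "(\<Sum>v\<in>pverts G. degree_of G v)
      = degree_of G u + ((\<Sum>v\<in>?N. degree_of G v) + (\<Sum>v\<in>?W. degree_of G v))"
    by (simp add: sum.union_disjoint)
  moreover have "(\<Sum>v\<in>pverts G. degree_of G v) = 2 * (3 * k + 1)"
  proof -
    have "parcs G \<inter> pverts G \<times> UNIV = parcs G" by (auto dest: in_arcsD1)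
    then show ?thesis unfolding sum_degree_of[OF subset_refl] by (simp add: card_parcs size)
  qed
  moreover have "(\<Sum>v\<in>?W. degree_of G v) = card (parcs G \<inter> ?N \<times> ?W) + card (parcs G \<inter> ?W \<times> ?W)"
  proof -
    have eq: "parcs G \<inter> ?W \<times> UNIV = parcs G \<inter> ?W \<times> ?N \<union> parcs G \<inter> ?W \<times> ?W"
      using u by (auto simp: far_def parcs_sym dest: in_arcsD2)
    have "?W \<subseteq> pverts G" "(parcs G \<inter> ?W \<times> ?N) \<inter> (parcs G \<inter> ?W \<times> ?W) = {}"
      by (auto simp: far_def)
    then show ?thesis
      unfolding card_arcs_swap[of ?N] by (simp add: sum_degree_of eq card_Un_disjoint fin)
  qed
  ultimately show ?thesis using sum_degree_nbrs[OF u] by (auto simp: algebra_simps)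
qed

text \<open>Two partners would put the edge from \<open>u\<close> to \<open>x\<close> in two
  triangles. So the neighbourhood induces a matching.\<close>

lemma partner_unique:
  assumes "x \<in> nbrs G u" "y \<in> nbrs G u" "z \<in> nbrs G u" "(x, y) \<in> parcs G" "(x, z) \<in> parcs G"
  shows "y = z"
  using no_theta_122[of u x y z] assms by (simp add: parcs_sym)

lemma card_matched: "card (matched u) = card (parcs G \<inter> nbrs G u \<times> nbrs G u)"
  unfolding matched_def
  by (rule card_image) (auto simp: inj_on_def dest: partner_unique)

lemma matched_subset: "matched u \<subseteq> nbrs G u"
  by (auto simp: matched_def)

lemma card_unmatched:
  "card (nbrs G u - matched u) + card (parcs G \<inter> nbrs G u \<times> nbrs G u) = degree_of G u"
  using card_mono[OF finite_nbrs matched_subset] finite_subset[OF matched_subset finite_nbrs]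
  by (simp add: card_Diff_subset matched_subset card_matched[symmetric] degree_of_eq_card_nbrs)

text \<open>Minimum degree 2 forces a neighbour of \<open>x\<close> besides \<open>u\<close>, and it
  is not in \<open>nbrs G u\<close> because \<open>x\<close> is unmatched.\<close>

lemma unmatched_far:
  assumes u: "u \<in> pverts G" and x: "x \<in> nbrs G u - matched u"
  obtains w where "w \<in> far u" "(x, w) \<in> parcs G"
proof -
  have "x \<in> pverts G" using x nbrs_subset by blast
  then obtain z where z: "(x, z) \<in> parcs G" "z \<noteq> u" by (rule other_neighbour)
  moreover have "z \<notin> nbrs G u" using x z by (force simp: matched_def)
  ultimately show thesis using edge_cases[OF u z(1)] x that by auto
qed

lemma unmatched_le:
  assumes "u \<in> pverts G"
  shows "card (nbrs G u - matched u) \<le> card (parcs G \<inter> nbrs G u \<times> far u)"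
proof -
  have "nbrs G u - matched u \<subseteq> fst ` (parcs G \<inter> nbrs G u \<times> far u)"
  proof
    fix x assume x: "x \<in> nbrs G u - matched u"
    then obtain w where "w \<in> far u" "(x, w) \<in> parcs G" by (rule unmatched_far[OF assms])
    with x show "x \<in> fst ` (parcs G \<inter> nbrs G u \<times> far u)" by force
  qed
  then show ?thesis
    using pair_finite_arcs by (meson card_image_le card_mono finite_Int finite_imageI le_trans)
qed

text \<open>Let \<open>x\<close> be a partner of \<open>y\<close>. If it is \<open>z\<close>, the
  edge \<open>y, z\<close> lies in triangles with \<open>u\<close> and with \<open>w\<close>.
  Otherwise the triangle \<open>u, x, y\<close> and the 4-cycle \<open>u, z, w, y\<close> share the
  edge \<open>u, y\<close>.\<close>

lemma far_matched:
  assumes "w \<in> far u" "(w, y) \<in> parcs G" "(w, z) \<in> parcs G" "z \<in> nbrs G u" "y \<noteq> z"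
  shows "y \<notin> matched u"
proof
  assume "y \<in> matched u"
  then obtain x where x: "(u, y) \<in> parcs G" "(u, x) \<in> parcs G" "(y, x) \<in> parcs G"
    by (auto simp: matched_def)
  have w: "w \<noteq> u" "(u, w) \<notin> parcs G" using assms(1) by (auto simp: far_def)
  show False
  proof (cases "x = z")
    case True
    then show ?thesis
      using no_theta_122[of y z u w] x assms w by (auto simp: parcs_sym)
  next
    case False
    then show ?thesis
      using no_theta_123[of u y x z w] x assms w by (auto simp: parcs_sym)
  qed
qed

lemma far_independent:
  assumes "u \<in> pverts G" "card (parcs G \<inter> far u \<times> far u) = 0" "w \<in> far u" "(w, z) \<in> parcs G"
  shows "z \<in> nbrs G u"
proof -
  have "parcs G \<inter> far u \<times> far u = {}" using assms(2) pair_finite_arcs by auto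
  then have "z \<notin> far u" using assms(3,4) by auto
  moreover have "z \<noteq> u" using assms(3,4) by (auto simp: far_def parcs_sym)
  ultimately show ?thesis using assms(4) by (auto simp: far_def dest: in_arcsD2)
qed

text \<open>Every unmatched neighbour sends an arc to \<open>far u\<close>, so the edge count yields
  3d \<le> 6k + 2 for the degree d.\<close>

lemma degree_of_le:
  assumes "u \<in> pverts G"
  shows "degree_of G u \<le> 2 * k"
  using edge_count[OF assms] card_unmatched[of u] unmatched_le[OF assms] by linarith

text \<open>Eliminating the arcs to \<open>far u\<close> from the two counts leaves at most 6k + 2
  plus the number of matched neighbours.\<close>

lemma sum_degree_nbrs_le:
  assumes "u \<in> pverts G"
  shows "2 * (\<Sum>v\<in>nbrs G u. degree_of G v) \<le> 6 * k + 2 + degree_of G u"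
  using edge_count[OF assms] card_unmatched[of u] sum_degree_nbrs[OF assms] by linarith

text \<open>The general bound gives only 4k here. Equality would leave one unmatched neighbour and
  no edge inside \<open>far u\<close>; then some far vertex is adjacent to it and to a matched
  neighbour, contrary to \<open>far_matched\<close>.\<close>

lemma sum_degree_nbrs_le':
  assumes u: "u \<in> pverts G" and d: "degree_of G u = 2 * k - 1"
  shows "(\<Sum>v\<in>nbrs G u. degree_of G v) \<le> 4 * k - 1"
proof (rule ccontr)
  assume neg: "\<not> ?thesis"
  note count = edge_count[OF u] card_unmatched[of u] sum_degree_nbrs[OF u]
  have "even (card (parcs G \<inter> nbrs G u \<times> nbrs G u))" "even (card (parcs G \<inter> far u \<times> far u))"
    by (rule even_card_induced)+
  then obtain s w where sw: "card (parcs G \<inter> nbrs G u \<times> nbrs G u) = 2 * s"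
    "card (parcs G \<inter> far u \<times> far u) = 2 * w" by (auto elim!: evenE)
  \<comment> \<open>\<open>c\<close> counts unmatched neighbours, \<open>e\<close> arcs to
    \<open>far u\<close>, and \<open>D\<close> is the degree sum. As \<open>d\<close> is odd, s
    \<le> k - 1, while D \<ge> 4k forces s \<ge> k - 1 + w.\<close>
  have arith: "w = 0 \<and> c = 1"
    if "6 * k + 2 = 2 * d + 2 * s + 2 * e + 2 * w" "c + 2 * s = d" "D = d + 2 * s + e"
      "\<not> D \<le> 4 * k - 1" "d = 2 * k - 1" for c d e D
  proof -
    have "d + 1 = 2 * k" "D \<ge> 4 * k" using that(4,5) k by linarith+
    moreover from this have "s + 1 \<le> k" using that(2) by linarith
    ultimately show ?thesis using that(1-3) by linarith
  qed
  have "w = 0 \<and> card (nbrs G u - matched u) = 1"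
    by (rule arith[OF count[unfolded sw] neg d])
  then have w0: "card (parcs G \<inter> far u \<times> far u) = 0" and "card (nbrs G u - matched u) = 1"
    using sw by simp_all
  then obtain x where x: "nbrs G u - matched u = {x}" by (auto simp: card_1_singleton_iff)
  then obtain y where y: "y \<in> far u" "(x, y) \<in> parcs G" using unmatched_far[OF u, of x] by blast
  then have "y \<in> pverts G" by (simp add: far_def)
  then obtain z where z: "(y, z) \<in> parcs G" "z \<noteq> x" by (rule other_neighbour)
  have "z \<in> nbrs G u" by (rule far_independent[OF u w0 y(1) z(1)])
  then have "z \<in> matched u" using x z(2) by blast
  moreover have "z \<notin> matched u"
    by (rule far_matched[OF y(1) z(1) _ _ z(2)]) (use x y parcs_sym in auto)
  ultimately show False by blast
qed

text \<open>With s edges inside \<open>nbrs G u\<close>, e leading to \<open>far u\<close> and t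
  inside it, the count reads s + e + t = k + 1. Since e \<ge> 2k - 2s, only s = k and s = k - 1
  remain; the latter forces t = 0 and two unmatched neighbours.\<close>

lemma max_degree_structure:
  assumes u: "u \<in> pverts G" and d: "degree_of G u = 2 * k"
  obtains S a b w \<pi> where
    "pverts G = insert u (insert w (insert a (insert b S)))"
    "distinct [u, w, a, b]" "S \<inter> {u, w, a, b} = {}" "finite S" "card S = 2 * (k - 1)"
    "\<And>x. x \<in> S \<Longrightarrow> \<pi> x \<in> S \<and> \<pi> x \<noteq> x \<and> \<pi> (\<pi> x) = x \<and> nbrs G x = {u, \<pi> x}"
    "nbrs G u = insert a (insert b S)" "nbrs G a = {u, w}" "nbrs G b = {u, w}" "nbrs G w = {a, b}"
proof -
  let ?N = "nbrs G u" and ?S = "matched u" and ?W = "far u"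
  note count = edge_count[OF u] card_unmatched[of u] unmatched_le[OF u]
  have "even (card (parcs G \<inter> ?N \<times> ?N))" "even (card (parcs G \<inter> ?W \<times> ?W))"
    by (rule even_card_induced)+
  then obtain s t where st: "card (parcs G \<inter> ?N \<times> ?N) = 2 * s" "card (parcs G \<inter> ?W \<times> ?W) = 2 * t"
    by (auto elim!: evenE)
  have uN: "u \<notin> ?N" by (auto dest: no_loops')
  \<comment> \<open>Here all neighbours are matched and one edge is left. If it leads to
    \<open>far u\<close>, its far end needs a second neighbour, against \<open>far_matched\<close>;
    if it lies inside \<open>far u\<close>, it is cut off from \<open>u\<close>.\<close>
  have "s \<noteq> k"
  proof
    assume "s = k"
    then have "card (?N - ?S) = 0" using count(2) d unfolding st by linarith
    then have NS: "?N = ?S" using finite_nbrs matched_subset by (metis Diff_eq_empty_iff card_0_eq finite_Diff subset_antisym)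
    have et: "card (parcs G \<inter> ?N \<times> ?W) + t = 1" using count(1) d \<open>s = k\<close> unfolding st by linarith
    show False
    proof (cases "t = 0")
      case True
      then have "parcs G \<inter> ?N \<times> ?W \<noteq> {}" using et by auto
      then obtain y w where yw: "y \<in> ?N" "w \<in> ?W" "(y, w) \<in> parcs G" by blast
      then have "w \<in> pverts G" by (simp add: far_def)
      then obtain z where z: "(w, z) \<in> parcs G" "z \<noteq> y" by (rule other_neighbour)
      have "card (parcs G \<inter> ?W \<times> ?W) = 0" using st True by simp
      from far_independent[OF u this yw(2) z(1)] have "z \<in> ?N" .
      with far_matched[OF yw(2) parcs_sym[OF yw(3)] z(1)] z(2) yw(1) NS show False by auto
    next
      case False
      then have "card (parcs G \<inter> ?N \<times> ?W) = 0" using et by linarith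
      then have e: "parcs G \<inter> ?N \<times> ?W = {}"
        using pair_finite_arcs by (meson card_0_eq finite_Int)
      have "insert u ?N = pverts G"
      proof (rule connected_closed_eq[OF conn])
        fix x y assume xy: "(x, y) \<in> parcs G" "x \<in> insert u ?N"
        show "y \<in> insert u ?N"
        proof (cases "x = u")
          case False
          then show ?thesis using edge_cases[OF u xy(1)] xy e by auto
        qed (use xy in auto)
      qed (use u nbrs_subset in auto)
      then have "?W = {}" by (auto simp: far_def)
      then show False using st False by simp
    qed
  qed
  then have s: "s = k - 1" and t: "t = 0" and e: "card (parcs G \<inter> ?N \<times> ?W) = 2"
    and "card (?N - ?S) = 2"
    using count d k unfolding st by linarith+
  then obtain a b where ab: "?N - ?S = {a, b}" "a \<noteq> b" by (auto simp: card_2_iff)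
  have w0: "card (parcs G \<inter> ?W \<times> ?W) = 0" using st t by simp
  obtain w where w: "w \<in> ?W" "(a, w) \<in> parcs G" using unmatched_far[OF u, of a] ab by blast
  then have wV: "w \<in> pverts G" by (simp add: far_def)
  \<comment> \<open>The second neighbour of \<open>w\<close> lies in \<open>?N\<close> but cannot be
    matched, so it is \<open>b\<close>.\<close>
  then obtain z where z: "(w, z) \<in> parcs G" "z \<noteq> a" by (rule other_neighbour)
  have "z \<in> ?N" by (rule far_independent[OF u w0 w(1) z(1)])
  moreover have "z \<notin> ?S"
    by (rule far_matched[OF w(1) z(1) _ _ z(2)]) (use ab w parcs_sym in auto)
  ultimately have zb: "z = b" using ab z(2) by blast
  \<comment> \<open>By \<open>e\<close> there are just two such arcs, so the two known ones exhaust
    them.\<close>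
  have NW: "parcs G \<inter> ?N \<times> ?W = {(a, w), (b, w)}"
    by (rule sym, rule card_subset_eq) (use pair_finite_arcs ab w z zb e parcs_sym in auto)
  have W: "?W = {w}"
  proof -
    have "w' = w" if w': "w' \<in> ?W" for w'
    proof -
      have "w' \<in> pverts G" using w' by (simp add: far_def)
      then obtain y where y: "(w', y) \<in> parcs G" by (rule other_neighbour)
      have "y \<in> ?N" by (rule far_independent[OF u w0 w' y])
      then have "(y, w') \<in> parcs G \<inter> ?N \<times> ?W" using y w' parcs_sym by auto
      then show ?thesis unfolding NW by auto
    qed
    with w(1) show ?thesis by blast
  qed
  have N: "?N = insert a (insert b ?S)" using ab matched_subset[of u] by auto
  have V: "pverts G = insert u (insert w (insert a (insert b ?S)))"
    using u nbrs_subset[of u] W unfolding far_def N by auto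
  have abN: "a \<in> ?N" "b \<in> ?N" "a \<notin> ?S" "b \<notin> ?S" using ab by auto
  have wN: "w \<notin> ?N" "w \<noteq> u" using w(1) by (auto simp: far_def)
  \<comment> \<open>The partner in the matching; \<open>THE\<close> is determinate for matched
    vertices by \<open>partner_unique\<close>.\<close>
  define \<pi> where "\<pi> x = (THE y. y \<in> ?N \<and> (x, y) \<in> parcs G)" for x
  have \<pi>_eq: "\<pi> x = y" if "x \<in> ?N" "y \<in> ?N" "(x, y) \<in> parcs G" for x y
    unfolding \<pi>_def using that partner_unique[of x u] by blast
  have nb: "nbrs G x = insert u {y. (x, y) \<in> parcs G \<and> (y \<in> ?N \<or> y = w)}" if "x \<in> ?N" for x
  proof (intro equalityI subsetI)
    fix y assume "y \<in> nbrs G x"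
    then have "(x, y) \<in> parcs G" by simp
    with edge_cases[OF u this that] W show "y \<in> insert u {y. (x, y) \<in> parcs G \<and> (y \<in> ?N \<or> y = w)}"
      by blast
  qed (use that parcs_sym in auto)
  have xw: "(x, w) \<in> parcs G \<longleftrightarrow> x = a \<or> x = b" if "x \<in> ?N" for x
    using that NW w(1) by blast
  have unm: "(x, y) \<notin> parcs G" if "x \<in> ?N" "x \<notin> ?S" "y \<in> ?N" for x y
    using that by (force simp: matched_def)
  show thesis
  proof (rule that)
    show "distinct [u, w, a, b]" using wN abN uN ab(2) by auto
    show "?S \<inter> {u, w, a, b} = {}" using wN abN uN matched_subset[of u] by auto
    show "finite ?S" using finite_subset[OF matched_subset finite_nbrs] .
    show "card ?S = 2 * (k - 1)" using st s card_matched by simp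
    show "nbrs G a = {u, w}" unfolding nb[OF abN(1)] using unm[OF abN(1,3)] w(2) by auto
    have "(b, w) \<in> parcs G" using xw[OF abN(2)] by simp
    then show "nbrs G b = {u, w}" unfolding nb[OF abN(2)] using unm[OF abN(2,4)] by auto
    show "nbrs G w = {a, b}"
    proof (intro equalityI subsetI)
      fix y assume "y \<in> nbrs G w"
      then have wy: "(w, y) \<in> parcs G" by simp
      have "y \<in> ?N" by (rule far_independent[OF u w0 w(1) wy])
      then show "y \<in> {a, b}" using xw parcs_sym[OF wy] by blast
    next
      fix y assume "y \<in> {a, b}"
      then show "y \<in> nbrs G w" using parcs_sym[OF w(2)] z(1) zb by auto
    qed
    fix x assume x: "x \<in> ?S"
    then have xN: "x \<in> ?N" using matched_subset by blast
    obtain y where y: "y \<in> ?N" "(x, y) \<in> parcs G" using x by (auto simp: matched_def)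
    have yS: "y \<in> ?S" using y xN parcs_sym by (force simp: matched_def)
    have 1: "\<pi> x = y" "\<pi> y = x" using \<pi>_eq xN y parcs_sym by blast+
    have 2: "y \<noteq> x" using y(2) no_loops' by blast
    have "x \<noteq> a" "x \<noteq> b" using x abN by auto
    then have "(x, w) \<notin> parcs G" using xw[OF xN] by simp
    then have "{y'. (x, y') \<in> parcs G \<and> (y' \<in> ?N \<or> y' = w)} = {y}"
      using y partner_unique[OF xN _ y(1) _ y(2)] by blast
    then have "nbrs G x = {u, y}" unfolding nb[OF xN] by simp
    with 1 2 yS show "\<pi> x \<in> ?S \<and> \<pi> x \<noteq> x \<and> \<pi> (\<pi> x) = x \<and> nbrs G x = {u, \<pi> x}" by simp
  qed (use V N in auto)
qed

end

section \<open>The extremal graph\<close>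

text \<open>Remove one pair \<open>x\<close>, \<open>\<pi> x\<close>, enumerate the rest, and put
  the pair last. Partners become consecutive, as in the triangles of the friendship graph.\<close>

lemma involution_enumeration:
  assumes "finite S" "card S = 2 * n" "\<And>x. x \<in> S \<Longrightarrow> \<pi> x \<in> S \<and> \<pi> x \<noteq> x \<and> \<pi> (\<pi> x) = x"
  shows "\<exists>f. bij_betw f {..<2 * n} S \<and> (\<forall>i<n. \<pi> (f (2 * i)) = f (2 * i + 1))"
  using assms
proof (induction n arbitrary: S)
  case 0
  then show ?case by (auto simp: bij_betw_def)
next
  case (Suc n)
  then obtain x where x: "x \<in> S" by fastforce
  let ?S = "S - {x, \<pi> x}"
  note inv = Suc.prems(3)
  have "card ?S = 2 * n"
  proof -
    have "card {x, \<pi> x} = 2" using inv[OF x] by auto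
    then show ?thesis using Suc.prems(1,2) inv[OF x] x by (simp add: card_Diff_subset)
  qed
  moreover have "\<pi> y \<in> ?S \<and> \<pi> y \<noteq> y \<and> \<pi> (\<pi> y) = y" if "y \<in> ?S" for y
    using inv[of y] inv[OF x] that by (metis Diff_iff insert_iff empty_iff)
  ultimately obtain f where f: "bij_betw f {..<2 * n} ?S" "\<forall>i<n. \<pi> (f (2 * i)) = f (2 * i + 1)"
    using Suc.IH[of ?S] Suc.prems(1) by auto
  define g where "g = f(2 * n := x, 2 * n + 1 := \<pi> x)"
  have gf: "g i = f i" if "i < 2 * n" for i using that by (simp add: g_def)
  have "bij_betw g {..<2 * n} ?S"
    using f(1) by (subst bij_betw_cong[of _ g f]) (auto simp: gf)
  moreover have "bij_betw g {2 * n, 2 * n + 1} {x, \<pi> x}"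
    using inv[OF x] by (auto simp: bij_betw_def g_def inj_on_def)
  ultimately have "bij_betw g ({..<2 * n} \<union> {2 * n, 2 * n + 1}) (?S \<union> {x, \<pi> x})"
    by (rule bij_betw_combine) auto
  moreover have "{..<2 * n} \<union> {2 * n, 2 * n + 1} = {..<2 * Suc n}" by auto
  moreover have "?S \<union> {x, \<pi> x} = S" using x inv[OF x] by auto
  moreover have "\<pi> (g (2 * i)) = g (2 * i + 1)" if "i < Suc n" for i
    using f(2) that by (cases "i = n") (auto simp: g_def)
  ultimately show ?case by auto
qed

text \<open>One orientation of each edge: \<open>n\<close> triangles at 0, then the 4-cycle through
  0.\<close>

definition H4_edges :: "nat \<Rightarrow> (nat \<times> nat) set" where
  "H4_edges n = (\<Union>i<n. {(0, 2 * i + 1), (0, 2 * i + 2), (2 * i + 1, 2 * i + 2)})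
     \<union> {(0, 2 * n + 1), (2 * n + 1, 2 * n + 2), (2 * n + 2, 2 * n + 3), (2 * n + 3, 0)}"

lemma map_prod_image_converse: "map_prod f f ` R\<inverse> = (map_prod f f ` R)\<inverse>"
  by force

lemma H_graph_4:
  "H_graph (2 * n + 1) 4 = graph_from_edges {..<2 * n + 4} (H4_edges n)"
proof -
  \<comment> \<open>The renaming of cycle vertices in \<open>H_graph\<close> for p =
    \<open>2 * n + 1\<close>.\<close>
  define f where "f i = (if i = 0 then 0 else 2 * n + 1 + i - 1)" for i
  have f: "f 0 = 0" "f 1 = 2 * n + 1" "f 2 = 2 * n + 2" "f 3 = 2 * n + 3" by (simp_all add: f_def)
  let ?C = "{(0, 1), (1, 2), (2, 3), (3, 0)} :: (nat \<times> nat) set"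
  let ?D = "{(0, 2 * n + 1), (2 * n + 1, 2 * n + 2), (2 * n + 2, 2 * n + 3), (2 * n + 3, 0)}"
  let ?F = "\<Union>i<n. {(0, 2 * i + 1), (0, 2 * i + 2), (2 * i + 1, 2 * i + 2)}"
  have four: "{..<4} = {0, 1, 2, 3 :: nat}" by auto
  have V: "pverts (cycle_graph 4) = {0, 1, 2, 3}" and E: "parcs (cycle_graph 4) = ?C \<union> ?C\<inverse>"
    unfolding cycle_graph_def graph_from_edges_def four by (simp_all flip: numeral_2_eq_2)
  have "f ` {0, 1, 2, 3} = {0, 2 * n + 1, 2 * n + 2, 2 * n + 3}"
    by (simp only: image_insert image_empty f)
  then have verts: "pverts (friendship_graph (2 * n + 1)) \<union> f ` pverts (cycle_graph 4) = {..<2 * n + 4}"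
    unfolding V by (auto simp: friendship_graph_def graph_from_edges_def)
  have "map_prod f f ` ?C = ?D"
    by (simp only: image_insert image_empty map_prod_simp f)
  then have "map_prod f f ` parcs (cycle_graph 4) = ?D \<union> ?D\<inverse>"
    unfolding E image_Un map_prod_image_converse by (rule arg_cong)
  moreover have "parcs (friendship_graph (2 * n + 1)) = ?F \<union> ?F\<inverse>"
  proof -
    have "(2 * n + 1 - 1) div 2 = n" by simp
    then show ?thesis by (simp only: friendship_graph_def graph_from_edges_def pair_pre_digraph.simps)
  qed
  ultimately have arcs: "parcs (friendship_graph (2 * n + 1)) \<union> map_prod f f ` parcs (cycle_graph 4)
      = H4_edges n \<union> (H4_edges n)\<inverse>"
    unfolding H4_edges_def by (simp only: converse_Un Un_ac)
  show ?thesis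
    unfolding H_graph_def Let_def f_def[symmetric] graph_from_edges_def[of _ "H4_edges n"] verts arcs ..
qed

lemma pair_wf_digraph_H_graph: "pair_wf_digraph (H_graph (2 * n + 1) 4)"
  unfolding H_graph_4 by unfold_locales (auto simp: graph_from_edges_def H4_edges_def)

text \<open>The centre misses only itself and the opposite cycle vertex \<open>2 * n + 2\<close>.
  For n = k - 1 its degree is \<open>2 * k\<close>.\<close>

lemma degree_of_H_graph_centre: "degree_of (H_graph (2 * n + 1) 4) 0 = 2 * n + 2"
proof -
  have "nbrs (graph_from_edges {..<2 * n + 4} (H4_edges n)) 0 = {1..2 * n + 1} \<union> {2 * n + 3}" (is "?L = ?R")
  proof (intro equalityI subsetI)
    fix x assume "x \<in> ?R"
    then consider "x = 2 * n + 1" | "x = 2 * n + 3" | i where "i < n" "x = 2 * i + 1 \<or> x = 2 * i + 2"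
    proof (cases "x < 2 * n + 1")
      case True
      with \<open>x \<in> ?R\<close> have "(x - 1) div 2 < n" "x = 2 * ((x - 1) div 2) + 1 \<or> x = 2 * ((x - 1) div 2) + 2"
        by auto
      with that(3) show thesis by blast
    qed auto
    then show "x \<in> ?L"
      by cases (auto simp: graph_from_edges_def H4_edges_def)
  qed (auto simp: graph_from_edges_def H4_edges_def)
  then show ?thesis unfolding H_graph_4 by (simp add: degree_of_eq_card_nbrs)
qed

lemma (in extremal_graph) max_degree_iso:
  assumes u: "u \<in> pverts G" and d: "degree_of G u = 2 * k"
  shows "graph_iso G (H_graph (2 * k - 1) 4)"
proof -
  obtain S a b w \<pi> where V: "pverts G = insert u (insert w (insert a (insert b S)))"
    and dist: "distinct [u, w, a, b]" "S \<inter> {u, w, a, b} = {}" and S: "finite S" "card S = 2 * (k - 1)"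
    and \<pi>: "\<And>x. x \<in> S \<Longrightarrow> \<pi> x \<in> S \<and> \<pi> x \<noteq> x \<and> \<pi> (\<pi> x) = x \<and> nbrs G x = {u, \<pi> x}"
    and nb: "nbrs G u = insert a (insert b S)" "nbrs G a = {u, w}" "nbrs G b = {u, w}" "nbrs G w = {a, b}"
    by (rule max_degree_structure[OF assms]) (rule that)
  define n where "n = k - 1"
  have p: "2 * k - 1 = 2 * n + 1" using k by (simp add: n_def)
  obtain f where f: "bij_betw f {..<2 * n} S" "\<And>i. i < n \<Longrightarrow> \<pi> (f (2 * i)) = f (2 * i + 1)"
    using involution_enumeration[OF S, of \<pi>] \<pi> unfolding n_def by blast
  \<comment> \<open>\<open>f\<close> counts from 0 but triangle vertices start at 1, hence the
    shift; \<open>a\<close>, \<open>w\<close>, \<open>b\<close> follow in cyclic order.\<close>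
  define h where "h j = (if j = 0 then u else if j \<le> 2 * n then f (j - 1)
    else if j = 2 * n + 1 then a else if j = 2 * n + 2 then w else b)" for j
  have fS: "f i \<in> S" if "i < 2 * n" for i using f(1) that by (auto simp: bij_betw_def)
  have h: "h 0 = u" "h (2 * n + 1) = a" "h (2 * n + 2) = w" "h (2 * n + 3) = b"
    "\<And>i. i < n \<Longrightarrow> h (2 * i + 1) = f (2 * i)" "\<And>i. i < n \<Longrightarrow> h (2 * i + 2) = f (2 * i + 1)"
    by (auto simp: h_def)
  have "bij_betw h {1..2 * n} S"
  proof -
    have "bij_betw (\<lambda>j. j - 1) {1..2 * n} {..<2 * n}"
      by (rule bij_betw_byWitness[of _ "\<lambda>j. j + 1"]) auto
    from bij_betw_trans[OF this f(1)] show ?thesis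
      by (subst bij_betw_cong[of _ h "f \<circ> (\<lambda>j. j - 1)"]) (auto simp: h_def)
  qed
  moreover have "bij_betw h {0, 2 * n + 1, 2 * n + 2, 2 * n + 3} {u, w, a, b}"
    using dist(1) h(1-4) by (auto simp: bij_betw_def inj_on_def)
  ultimately have "bij_betw h ({1..2 * n} \<union> {0, 2 * n + 1, 2 * n + 2, 2 * n + 3}) (S \<union> {u, w, a, b})"
    by (rule bij_betw_combine) (use dist(2) in auto)
  moreover have "{1..2 * n} \<union> {0, 2 * n + 1, 2 * n + 2, 2 * n + 3} = {..<2 * n + 4}" by auto
  moreover have "S \<union> {u, w, a, b} = pverts G" using V by auto
  ultimately have bij: "bij_betw h {..<2 * n + 4} (pverts G)" by simp
  define E where "E = (\<Union>i<n. {(u, f (2 * i)), (u, f (2 * i + 1)), (f (2 * i), f (2 * i + 1))})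
    \<union> {(u, a), (a, w), (w, b), (b, u)}"
  have hE: "map_prod h h ` H4_edges n = E"
  proof -
    have "map_prod h h ` (\<Union>i<n. {(0, 2 * i + 1), (0, 2 * i + 2), (2 * i + 1, 2 * i + 2)})
      = (\<Union>i<n. {(u, f (2 * i)), (u, f (2 * i + 1)), (f (2 * i), f (2 * i + 1))})"
      unfolding image_UN
    proof (intro SUP_cong refl)
      fix i assume "i \<in> {..<n}"
      then have "i < n" by simp
      from h(5,6)[OF this] show "map_prod h h ` {(0, 2 * i + 1), (0, 2 * i + 2), (2 * i + 1, 2 * i + 2)}
        = {(u, f (2 * i)), (u, f (2 * i + 1)), (f (2 * i), f (2 * i + 1))}"
        by (simp only: image_insert image_empty map_prod_simp h(1))
    qed
    then show ?thesis
      unfolding H4_edges_def E_def image_Un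
      by (simp only: image_insert image_empty map_prod_simp h(1-4))
  qed
  have hE': "map_prod h h ` (H4_edges n)\<inverse> = E\<inverse>"
    by (simp only: map_prod_image_converse hE)
  have pi_arc: "(x, \<pi> x) \<in> parcs G" "(u, x) \<in> parcs G" if "x \<in> S" for x
  proof -
    have "\<pi> x \<in> nbrs G x" "u \<in> nbrs G x" using \<pi>[OF that] by auto
    then show "(x, \<pi> x) \<in> parcs G" "(u, x) \<in> parcs G" by (auto intro: parcs_sym)
  qed
  have EG: "E \<subseteq> parcs G"
  proof -
    have "(u, f (2 * i)) \<in> parcs G" "(u, f (2 * i + 1)) \<in> parcs G" "(f (2 * i), f (2 * i + 1)) \<in> parcs G"
      if "i < n" for i
      using that pi_arc[OF fS[of "2 * i"]] pi_arc[OF fS[of "2 * i + 1"]] f(2)[OF that] by auto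
    moreover have "a \<in> nbrs G u" "w \<in> nbrs G a" "b \<in> nbrs G w" "u \<in> nbrs G b" using nb by auto
    ultimately show ?thesis by (auto simp: E_def)
  qed
  \<comment> \<open>\<open>E\<close> holds each partner pair in one orientation; the parity of the
    position of \<open>x\<close> decides which.\<close>
  have S_cases: "(u, x) \<in> E \<and> ((x, \<pi> x) \<in> E \<or> (\<pi> x, x) \<in> E)" if "x \<in> S" for x
  proof -
    obtain j where j: "j < 2 * n" "x = f j" using f(1) \<open>x \<in> S\<close> by (auto simp: bij_betw_def)
    let ?i = "j div 2"
    have i: "?i < n" using j by auto
    have 1: "\<pi> (f (2 * ?i)) = f (2 * ?i + 1)" by (rule f(2)[OF i])
    then have 2: "\<pi> (f (2 * ?i + 1)) = f (2 * ?i)"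
      using \<pi>[OF fS[of "2 * ?i"]] i by (metis mult_less_mono2 zero_less_numeral)
    have E: "{(u, f (2 * ?i)), (u, f (2 * ?i + 1)), (f (2 * ?i), f (2 * ?i + 1))} \<subseteq> E"
      using i unfolding E_def by blast
    show ?thesis
    proof (cases "even j")
      case True
      then have "x = f (2 * ?i)" using j by simp
      then show ?thesis using 1 E by simp
    next
      case False
      then have "x = f (2 * ?i + 1)" using j by simp
      then show ?thesis using 2 E by simp
    qed
  qed
  have E4: "(u, a) \<in> E" "(a, w) \<in> E" "(w, b) \<in> E" "(b, u) \<in> E" by (auto simp: E_def)
  have arcs: "parcs G = E \<union> E\<inverse>"
  proof (intro equalityI subrelI)
    fix x y assume xy: "(x, y) \<in> parcs G"
    then have y: "y \<in> nbrs G x" by simp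
    have "x = u \<or> x = w \<or> x = a \<or> x = b \<or> x \<in> S" using in_arcsD1[OF xy] V by blast
    then show "(x, y) \<in> E \<union> E\<inverse>"
    proof (elim disjE)
      assume "x = u"
      with y have "y = a \<or> y = b \<or> y \<in> S" using nb(1) by blast
      then show ?thesis using \<open>x = u\<close> E4 S_cases by blast
    next
      assume "x \<in> S"
      then have "y = u \<or> y = \<pi> x" using y \<pi> by blast
      then show ?thesis using S_cases[OF \<open>x \<in> S\<close>] by blast
    qed (use y nb E4 in \<open>auto simp del: nbrs_iff\<close>)
  next
    fix x y assume "(x, y) \<in> E \<union> E\<inverse>"
    then show "(x, y) \<in> parcs G" using EG parcs_sym by blast
  qed
  have "graph_iso (H_graph (2 * n + 1) 4) G"
  proof (rule graph_isoI[OF pair_wf_digraph_H_graph])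
    show "inj_on h (pverts (H_graph (2 * n + 1) 4))" "pverts G = h ` pverts (H_graph (2 * n + 1) 4)"
      using bij unfolding H_graph_4 by (simp_all add: graph_from_edges_def bij_betw_def)
    show "parcs G = map_prod h h ` parcs (H_graph (2 * n + 1) 4)"
      unfolding H_graph_4 by (simp add: graph_from_edges_def image_Un hE hE' arcs)
  qed
  from graph_iso_sym[OF pair_wf_digraph_H_graph this] show ?thesis unfolding p .
qed

section \<open>The spectral bound\<close>

context extremal_graph
begin

definition radius :: real where "radius = q_bound (3 * k + 1)"

lemma radius_gt: "radius > 2 * real k + 1 + 1 / (2 * real k - 1)" "radius > 2 * real k + 1" "radius > 9"
proof -
  show 1: "radius > 2 * real k + 1 + 1 / (2 * real k - 1)"
    unfolding radius_def by (rule q_bound_root(2)[OF k refl])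
  have "1 / (2 * real k - 1) > 0" using k by simp
  with 1 show "radius > 2 * real k + 1" by linarith
  with k show "radius > 9" by linarith
qed

lemma pverts_nonempty: "pverts G \<noteq> {}"
  using conn unfolding connected_conv by simp

text \<open>A positive eigenvector puts its eigenvalue in the spectrum and, used as the weight in
  \<open>eigenfun_bound\<close>, bounds all others by it.\<close>

lemma max_degree_radius:
  assumes u: "u \<in> pverts G" and d: "degree_of G u = 2 * k"
  shows "signless_radius G = radius"
proof -
  obtain S a b w \<pi> where V: "pverts G = insert u (insert w (insert a (insert b S)))"
    and dist: "distinct [u, w, a, b]" "S \<inter> {u, w, a, b} = {}" and S: "finite S" "card S = 2 * (k - 1)"
    and \<pi>: "\<And>x. x \<in> S \<Longrightarrow> \<pi> x \<in> S \<and> \<pi> x \<noteq> x \<and> \<pi> (\<pi> x) = x \<and> nbrs G x = {u, \<pi> x}"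
    and nb: "nbrs G u = insert a (insert b S)" "nbrs G a = {u, w}" "nbrs G b = {u, w}" "nbrs G w = {a, b}"
    by (rule max_degree_structure[OF assms]) (rule that)
  define r D where "r = radius" and "D = (r - 2)\<^sup>2 - 2"
  have r: "r > 9" using radius_gt by (simp add: r_def)
  have "(r - 2)\<^sup>2 \<ge> 7\<^sup>2" using r by (intro power_mono) auto
  then have D: "D > 0" by (simp add: D_def)
  have root: "((r - 2 * real k) * (r - 3) - 2 * (real k - 1)) * D - 2 * (r - 2) * (r - 3) = 0"
    using q_bound_root(1)[OF k refl] poly_q_poly[OF refl, of k r]
    by (simp add: r_def D_def radius_def)
  \<comment> \<open>Put 1 at \<open>u\<close> and solve the remaining equations:
    \<open>(r - 3) * y x = 1\<close> on triangles, \<open>(r - 2) * y a = 1 + y w\<close> and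
    \<open>(r - 2) * y w = 2 * y a\<close> on the 4-cycle.\<close>
  define y where "y v = (if v = u then 1 else if v \<in> S then 1 / (r - 3)
    else if v = w then 2 / D else (r - 2) / D)" for v
  have y: "y u = 1" "\<And>x. x \<in> S \<Longrightarrow> y x = 1 / (r - 3)" "y w = 2 / D" "y a = (r - 2) / D" "y b = (r - 2) / D"
    using dist by (auto simp: y_def)
  have pos: "y v > 0" for v using r D by (simp add: y_def)
  have eigen: "real (degree_of G v) * y v + (\<Sum>x\<in>nbrs G v. y x) = r * y v" if "v \<in> pverts G" for v
  proof -
    have "v = u \<or> v = w \<or> v = a \<or> v = b \<or> v \<in> S" using that unfolding V by simp
    then consider "v = u" | "v = w" | "v = a \<or> v = b" | "v \<in> S" by blast
    then show ?thesis
    proof cases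
      \<comment> \<open>The equation at the centre is \<open>root\<close> divided by
        \<open>(r - 3) * D\<close>.\<close>
      case 1
      have "(\<Sum>x\<in>S. y x) = 2 * (real k - 1) * (1 / (r - 3))"
        using S k by (simp add: y(2) of_nat_diff)
      then have "(\<Sum>x\<in>nbrs G u. y x) = 2 * (r - 2) / D + 2 * (real k - 1) / (r - 3)"
        unfolding nb using dist S y by simp
      also have "\<dots> = r - 2 * real k"
        using root D r by (simp add: field_simps)
      finally show ?thesis by (simp add: 1 d y(1))
    next
      case 2
      have "degree_of G w = 2" "(\<Sum>x\<in>nbrs G w. y x) = 2 * (r - 2) / D"
        using dist y by (simp_all add: degree_of_eq_card_nbrs nb)
      then show ?thesis using D by (simp add: 2 y(3) field_simps)
    next
      case 3
      have vals: "degree_of G v = 2" "(\<Sum>x\<in>nbrs G v. y x) = 1 + 2 / D" "y v = (r - 2) / D"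
        using dist y 3 by (auto simp: degree_of_eq_card_nbrs nb)
      have "(r - 2) * (r - 2) = D + 2" by (simp add: D_def power2_eq_square)
      then have "(r - 2) * ((r - 2) / D) = 1 + 2 / D" using D by (simp add: field_simps)
      moreover have "real 2 * x + z = r * x" if "(r - 2) * x = z" for x z
        using that by (simp add: left_diff_distrib)
      ultimately show ?thesis unfolding vals by blast
    next
      case 4
      note p = \<pi>[OF 4]
      have "\<pi> v \<noteq> u" using p dist by auto
      then have "degree_of G v = 2" "(\<Sum>x\<in>nbrs G v. y x) = 1 + 1 / (r - 3)"
        using p y by (simp_all add: degree_of_eq_card_nbrs)
      then show ?thesis using r 4 by (simp add: y(2) field_simps)
    qed
  qed
  have "is_eigenfun G y r"
    unfolding is_eigenfun_def using eigen u pos[of u] by (metis less_irrefl)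
  then have "r \<in> spectrum (signless_laplacian G)"
    by (auto simp: spectrum_def eigenvalue_signless_laplacian_iff)
  then have "r \<le> signless_radius G"
    unfolding signless_radius_def using signless_radius_mem(1)[OF pverts_nonempty] by (rule Max_ge[rotated])
  moreover have "signless_radius G \<le> r"
  proof -
    obtain f where "is_eigenfun G f (signless_radius G)"
      using signless_radius_mem(2)[OF pverts_nonempty]
      by (auto simp: spectrum_def eigenvalue_signless_laplacian_iff)
    then obtain v where v: "v \<in> pverts G"
      "signless_radius G * y v \<le> real (degree_of G v) * y v + (\<Sum>w\<in>nbrs G v. y w)"
      using eigenfun_bound[of f "signless_radius G" y] pos by blast
    then show ?thesis using eigen[OF v(1)] pos[of v] by simp
  qed
  ultimately show ?thesis by (simp add: r_def)
qed

lemma small_degree_radius: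
  assumes small: "\<And>u. u \<in> pverts G \<Longrightarrow> degree_of G u \<noteq> 2 * k"
  shows "signless_radius G < radius"
proof -
  obtain f where f: "is_eigenfun G f (signless_radius G)"
    using signless_radius_mem(2)[OF pverts_nonempty]
    by (auto simp: spectrum_def eigenvalue_signless_laplacian_iff)
  define y where "y v = real (degree_of G v)" for v
  have pos: "y v > 0" if "v \<in> pverts G" for v using degree_of_ge_2[OF that] by (simp add: y_def)
  obtain u where u: "u \<in> pverts G"
    "signless_radius G * y u \<le> real (degree_of G u) * y u + (\<Sum>w\<in>nbrs G u. y w)"
    by (rule eigenfun_bound[OF f pos])
  define d D where "d = y u" and "D = (\<Sum>w\<in>nbrs G u. y w)"
  have D: "D = real (\<Sum>w\<in>nbrs G u. degree_of G w)" by (simp add: D_def y_def)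
  have d2: "d \<ge> 2" using degree_of_ge_2[OF u(1)] by (simp add: d_def y_def)
  have "degree_of G u = 2 * k - 1 \<or> degree_of G u + 2 \<le> 2 * k"
    using small[OF u(1)] degree_of_le[OF u(1)] by linarith
  then have "d * d + D < radius * d"
  proof
    assume deg: "degree_of G u = 2 * k - 1"
    have dk: "d = 2 * real k - 1" using deg k by (simp add: d_def y_def of_nat_diff)
    have "real (\<Sum>w\<in>nbrs G u. degree_of G w) \<le> real (4 * k - 1)"
      using sum_degree_nbrs_le'[OF u(1) deg] by (simp only: of_nat_le_iff)
    then have "D \<le> 4 * real k - 1" using k by (simp add: D of_nat_diff)
    \<comment> \<open>As 2k = d + 1, both \<open>d * d + (4 * real k - 1)\<close> and the right-hand
      side equal (d + 1)^2.\<close>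
    then have "d * d + D \<le> (2 * real k + 1 + 1 / d) * d"
      using d2 by (simp add: dk algebra_simps)
    also have "\<dots> < radius * d"
      using radius_gt(1) d2 by (simp add: dk)
    finally show ?thesis .
  next
    assume "degree_of G u + 2 \<le> 2 * k"
    then have dk: "d \<le> 2 * real k - 2" by (simp add: d_def y_def)
    have "real (2 * (\<Sum>w\<in>nbrs G u. degree_of G w)) \<le> real (6 * k + 2 + degree_of G u)"
      using sum_degree_nbrs_le[OF u(1)] by (simp only: of_nat_le_iff)
    then have "2 * D \<le> 6 * real k + 2 + d" by (simp add: D d_def y_def)
    \<comment> \<open>Convexity: between 2 and 2k - 2 the square lies below its chord.\<close>
    moreover have "(d - 2) * (2 * real k - 2 - d) \<ge> 0" using d2 dk by simp
    then have "d * d \<le> 2 * real k * d - 4 * real k + 4" by (simp add: algebra_simps)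
    ultimately have "d * d + D \<le> 2 * real k * d + d / 2 - real k + 5" by linarith
    \<comment> \<open>This amounts to 5 \<le> k + d/2, an equality at k = 4, d = 2.\<close>
    also have "\<dots> \<le> (2 * real k + 1) * d"
      using d2 k by (simp add: algebra_simps)
    also have "\<dots> < radius * d"
      using radius_gt(2) d2 by simp
    finally show ?thesis .
  qed
  moreover have "signless_radius G * d \<le> d * d + D" using u(2) by (simp add: d_def D_def y_def)
  ultimately have "signless_radius G * d < radius * d" by linarith
  then show ?thesis using d2 by simp
qed

end

theorem theorem4p1:
  fixes G :: "'a pair_pre_digraph" and k m :: nat
  assumes "k \<ge> 4" and "m = 3 * k + 1"
    and "pair_graph G"
    and "Digraph_Component.connected (with_proj G)"
    and "free_of {theta_graph [1, 2, 2], theta_graph [1, 2, 3]} G"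
    and "graph_size G = m"
    and "\<not> (\<exists>v. pendant_vertex G v)"
  shows "signless_radius G \<le> q_bound m
    \<and> (signless_radius G = q_bound m \<longleftrightarrow> graph_iso G (H_graph ((2 * m - 5) div 3) 4))"
proof -
  interpret pair_graph G by fact
  interpret extremal_graph G k
    using assms by unfold_locales auto
  have p: "(2 * m - 5) div 3 = 2 * k - 1" "2 * k - 1 = 2 * (k - 1) + 1"
    using assms(1,2) by auto
  have r: "radius = q_bound m" by (simp add: radius_def assms(2))
  show ?thesis
  \<comment> \<open>Both sides of the equivalence hold if a vertex of degree \<open>2 * k\<close>
    exists, and both fail otherwise.\<close>
  proof (cases "\<exists>u\<in>pverts G. degree_of G u = 2 * k")
    case True
    then show ?thesis using max_degree_radius max_degree_iso r p by auto
  next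
    case False
    have "\<not> graph_iso G (H_graph (2 * k - 1) 4)"
    proof
      assume iso: "graph_iso G (H_graph (2 * k - 1) 4)"
      have "0 \<in> pverts (H_graph (2 * k - 1) 4)"
        unfolding p(2) H_graph_4 by (simp add: graph_from_edges_def)
      from graph_iso_degree_of[OF iso this] show False
        using False degree_of_H_graph_centre[of "k - 1"] assms(1) unfolding p(2) by auto
    qed
    with False show ?thesis using small_degree_radius r p by auto
  qed
qed

end
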